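(* Let $n,m,\tilde r\in\mathbb N$ with $\tilde r>m$ and $\tilde R=\frac{(\tilde r+1)(\tilde r+2)}{2}<n^\star=(n+1)^2$, let $M=\frac{(m+1)(m+2)}{2}$, and let $S_{n,n}\subset D_1$, the basis $u_1,\dots,u_{\tilde R}$ of $\mathbb P_{\tilde r}(\mathbb R^2)$, the mock-optimal nodes $\Sigma_m'\subset S_{n,n}$, the matrices $\mathcal M,\mathcal C,\mathcal Q_{\mathcal C},\mathcal R_{11},\mathcal R_{12},\mathcal M_1,\mathcal V_1$ and the interpolation-regression operator $\hat\Pi_{\tilde r,n}:C(D_1,\mathbb R)\to\mathbb P_{\tilde r}(\mathbb R^2)$ be as defined in the context, where it is assumed that $\operatorname{rank}(\mathcal M)=\tilde R$, $\operatorname{rank}(\mathcal C)=M$ and $\mathcal R_{11}$ is nonsingular. Then the operator norm $\|\hat\Pi_{\tilde r,n}\|_\infty:=\sup_{\|f\|_\infty=1}\|\hat\Pi_{\tilde r,n}[f]\|_\infty$ satisfies $$\left\|\hat\Pi_{\tilde r,n}\right\|_\infty\le \max_{i=1,\dots,\tilde R}\|u_i\|_\infty\,\bigl(K_1(n,m)+K_2(n,m)\bigr),$$ where $$K_1(n,m)=\left\|\mathcal R_{11}^{-1}\right\|_1\left(M\left\|\mathcal Q_{\mathcal C}^T\right\|_1+\left\|\mathcal R_{12}\right\|_1K_2(n,m)\right),$$ $$K_2(n,m)=\left\|(\mathcal V_1^T\mathcal V_1)^{-1}\mathcal V_1^T\right\|_1\left(n^\star+M\left\|\mathcal M_1\mathcal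 R_{11}^{-1}\mathcal Q_{\mathcal C}^T\right\|_1\right).$$
   Context: Notation. $D_1$ is the closed unit disk in $\mathbb R^2$; $C(D_1,\mathbb R)$ is the space of continuous real functions on $D_1$, with $\|f\|_\infty=\max_{\boldsymbol x\in D_1}|f(\boldsymbol x)|$ (polynomials are regarded as functions on $D_1$). $\mathbb P_d(\mathbb R^2)$ is the space of real bivariate polynomials of total degree at most $d$. For vectors $\|\cdot\|_1$ is the $\ell^1$ norm, for matrices the induced operator norm (maximum absolute column sum). Sampling set. $S_{n,n}=\{(r_\eta\cos\theta_\kappa,r_\eta\sin\theta_\kappa):\eta,\kappa=0,\dots,n\}\subset D_1$ with $0<r_0<\dots<r_n\le1$ and $0\le\theta_0<\dots<\theta_n<2\pi$; it has $n^\star=(n+1)^2$ points, enumerated as $\boldsymbol x_1,\dots,\boldsymbol x_{n^\star}$. Optimal nodes. Put $K=\lfloor m/2\rfloor+1$ and, for $\nu=1,\dots,K$, $m_\nu=2m+5-4\nu$, $\zeta_{\nu,m}=\cos\left(\frac{(2\nu-1)\pi}{2(m+1)}\right)$, $\rho_\nu^{\mathrm{opt}}=1.1565\,\zeta_{\nu,m}-0.76535\,\zeta_{\nu,m}^2+0.60517\,\zeta_{\nu,m}^3$. The optimal nodes are $\boldsymbol p_{\nu,\sigma}^{\mathrm{opt}}=\left(\rho_\nu^{\mathrm{opt}}\cos\frac{2\pi(\sigma-1)}{m_\nu},\rho_\nu^{\mathrm{opt}}\sin\frac{2\pi(\sigma-1)}{m_\nu}\right)$, $\sigma=1,\dots,m_\nu$,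 $\nu=1,\dots,K$; there are $M=\sum_\nu m_\nu$ of them. Mock-optimal nodes. Going through the optimal nodes one after the other (in a fixed order), one selects for each the point of $S_{n,n}$ closest to it (Euclidean norm; ties broken arbitrarily) among those not already selected. The $M$ distinct selected points $\boldsymbol x_1',\dots,\boldsymbol x_M'$ form the set $\Sigma_m'$. Basis and matrices. $\{u_1,\dots,u_{\tilde R}\}$ is a basis of $\mathbb P_{\tilde r}(\mathbb R^2)$ with $\operatorname{span}\{u_1,\dots,u_M\}=\mathbb P_m(\mathbb R^2)$. $\mathcal M=[u_j(\boldsymbol x_i)]\in\mathbb R^{n^\star\times\tilde R}$ and $\mathcal C=[u_j(\boldsymbol x_i')]\in\mathbb R^{M\times\tilde R}$. Standing assumptions: $\operatorname{rank}(\mathcal M)=\tilde R$, $\operatorname{rank}(\mathcal C)=M$. Operator. For $f\in C(D_1,\mathbb R)$ let $\boldsymbol b=[f(\boldsymbol x_1),\dots,f(\boldsymbol x_{n^\star})]^T$ and $\boldsymbol d=[f(\boldsymbol x_1'),\dots,f(\boldsymbol x_M')]^T$. Then $\hat\Pi_{\tilde r,n}[f]=\sum_{i=1}^{\tilde R}\hat a_iu_i$, where $\hat{\boldsymbol a}=[\hat a_1,\dots,\hat a_{\tilde R}]^T$ is determined by the (uniquely solvable) KKT system $$\begin{bmatrix}2\mathcal M^T\mathcal M&\mathcal C^T\\ \mathcal C&0\end{bmatrix}\begin{bmatrix}\hat{\boldsymbol a}\\ \hat{\boldsymbol z}\end{bmatrix}=\begin{bmatrix}2\mathcal M^T\boldsymbol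 b\\ \boldsymbol d\end{bmatrix},$$ i.e. $\hat{\boldsymbol a}$ is the unique minimizer of $\|\mathcal M\boldsymbol a-\boldsymbol b\|_2$ over $\boldsymbol a\in\mathbb R^{\tilde R}$ subject to $\mathcal C\boldsymbol a=\boldsymbol d$. Block decomposition. $\mathcal C=\mathcal Q_{\mathcal C}\mathcal R_{\mathcal C}$ is a QR factorization with $\mathcal Q_{\mathcal C}\in\mathbb R^{M\times M}$ orthogonal and $\mathcal R_{\mathcal C}\in\mathbb R^{M\times\tilde R}$ upper trapezoidal, written $\mathcal R_{\mathcal C}=[\mathcal R_{11},\mathcal R_{12}]$ with $\mathcal R_{11}\in\mathbb R^{M\times M}$ (assumed nonsingular) and $\mathcal R_{12}\in\mathbb R^{M\times(\tilde R-M)}$. Write $\mathcal M=[\mathcal M_1,\mathcal M_2]$ with $\mathcal M_1\in\mathbb R^{n^\star\times M}$, $\mathcal M_2\in\mathbb R^{n^\star\times(\tilde R-M)}$, and set $\mathcal V_1=\mathcal M_2-\mathcal M_1\mathcal R_{11}^{-1}\mathcal R_{12}\in\mathbb R^{n^\star\times(\tilde R-M)}$. *)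

theory Defs
  imports
    "HOL-Analysis.Topology_Euclidean_Space"
    "HOL-Library.Function_Algebras"
    "HOL-Library.Extended_Real"
    "Jordan_Normal_Form.Gauss_Jordan_Elimination"
    "Jordan_Normal_Form.DL_Rank"
begin

no_notation Finite_Cartesian_Product.vec_nth (infixl \<open>$\<close> 90)

section \<open>Functions on the unit disk\<close>

text \<open>
  The plane is \<^typ>\<open>real \<times> real\<close>, whose norm is the Euclidean one. A function on the disk is
  represented by a function on the whole plane, of which only the values on the disk matter.
\<close>

definition disk :: "(real \<times> real) set" where
  "disk = cball 0 1"

text \<open>On continuous functions the supremum is the maximum, since the disk is compact.\<close>

definition sup_norm :: "(real \<times> real \<Rightarrow> real) \<Rightarrow> real" where
  "sup_norm f = (SUP z\<in>disk. \<bar>f z\<bar>)"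

text \<open>
  The operator norm takes values in \<^typ>\<open>ereal\<close>, so that an upper bound on it also expresses
  boundedness of the operator (the supremum of an unbounded set of reals is unspecified).
\<close>

definition op_norm :: "((real \<times> real \<Rightarrow> real) \<Rightarrow> (real \<times> real \<Rightarrow> real)) \<Rightarrow> ereal" where
  "op_norm T = (SUP f\<in>{f. continuous_on disk f \<and> sup_norm f = 1}. ereal (sup_norm (T f)))"

global_interpretation fun_vs:
  Vector_Spaces.vector_space "\<lambda>(c::real) (f :: real \<times> real \<Rightarrow> real) z. c * f z"
  by unfold_locales (auto simp: fun_eq_iff algebra_simps)

definition poly_space :: "nat \<Rightarrow> (real \<times> real \<Rightarrow> real) set" where
  "poly_space d = fun_vs.span {\<lambda>(x, y). x ^ i * y ^ j | i j. i + j \<le> d}"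

definition is_basis_of ::
    "nat \<Rightarrow> (nat \<Rightarrow> real \<times> real \<Rightarrow> real) \<Rightarrow> (real \<times> real \<Rightarrow> real) set \<Rightarrow> bool" where
  "is_basis_of N u V \<longleftrightarrow>
     inj_on u {..<N} \<and> fun_vs.independent (u ` {..<N}) \<and> fun_vs.span (u ` {..<N}) = V"


section \<open>Sampling set and nodes\<close>

definition polar :: "real \<Rightarrow> real \<Rightarrow> real \<times> real" where
  "polar \<rho> \<theta> = (\<rho> * cos \<theta>, \<rho> * sin \<theta>)"

definition is_sampling_set :: "nat \<Rightarrow> (real \<times> real) set \<Rightarrow> bool" where
  "is_sampling_set n S \<longleftrightarrow>
     (\<exists>r \<theta>. 0 < r 0 \<and> strict_mono_on {..n} r \<and> r n \<le> 1 \<and>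
            0 \<le> \<theta> 0 \<and> strict_mono_on {..n} \<theta> \<and> \<theta> n < 2 * pi \<and>
            S = {polar (r \<eta>) (\<theta> \<kappa>) | \<eta> \<kappa>. \<eta> \<le> n \<and> \<kappa> \<le> n})"

text \<open>For \<open>1 \<le> \<nu> \<le> m div 2 + 1\<close> the natural-number subtraction below does not truncate.\<close>

definition opt_count :: "nat \<Rightarrow> nat \<Rightarrow> nat" where
  "opt_count m \<nu> = 2 * m + 5 - 4 * \<nu>"

definition opt_zeta :: "nat \<Rightarrow> nat \<Rightarrow> real" where
  "opt_zeta m \<nu> = cos ((2 * real \<nu> - 1) * pi / (2 * (real m + 1)))"

definition opt_radius :: "nat \<Rightarrow> nat \<Rightarrow> real" where
  "opt_radius m \<nu> =
     1.1565 * opt_zeta m \<nu> - 0.76535 * (opt_zeta m \<nu>)\<^sup>2 + 0.60517 * (opt_zeta m \<nu>) ^ 3"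

definition opt_node :: "nat \<Rightarrow> nat \<times> nat \<Rightarrow> real \<times> real" where
  "opt_node m = (\<lambda>(\<nu>, \<sigma>).
     polar (opt_radius m \<nu>) (2 * pi * (real \<sigma> - 1) / real (opt_count m \<nu>)))"

definition opt_indices :: "nat \<Rightarrow> (nat \<times> nat) set" where
  "opt_indices m = (SIGMA \<nu>:{1..m div 2 + 1}. {1..opt_count m \<nu>})"

text \<open>
  \<open>e\<close> is the order in which the optimal nodes are visited, and \<open>s k\<close> is the sampling point selected
  for the \<open>k\<close>-th of them; \<^const>\<open>is_arg_min\<close> leaves the breaking of ties open.
\<close>

definition is_mock_optimal :: "nat \<Rightarrow> (real \<times> real) set \<Rightarrow> (real \<times> real) set \<Rightarrow> bool" where
  "is_mock_optimal m S \<Sigma> \<longleftrightarrow>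
     (\<exists>e s. bij_betw e {..<card (opt_indices m)} (opt_indices m) \<and>
            (\<forall>k<card (opt_indices m).
               is_arg_min (\<lambda>x. dist x (opt_node m (e k))) (\<lambda>x. x \<in> S - s ` {..<k}) (s k)) \<and>
            \<Sigma> = s ` {..<card (opt_indices m)})"


section \<open>Matrices\<close>

definition vec_norm1 :: "real vec \<Rightarrow> real" where
  "vec_norm1 v = (\<Sum>i<dim_vec v. \<bar>v $ i\<bar>)"

definition mat_norm1 :: "real mat \<Rightarrow> real" where
  "mat_norm1 A =
     (SUP v\<in>carrier_vec (dim_col A) - {0\<^sub>v (dim_col A)}. vec_norm1 (A *\<^sub>v v) / vec_norm1 v)"

lemma mat_norm1_eq_max_col_sum:
  assumes "0 < dim_col A"
  shows "mat_norm1 A = Max ((\<lambda>j. \<Sum>i<dim_row A. \<bar>A $$ (i, j)\<bar>) ` {..<dim_col A})"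
proof -
  let ?c = "\<lambda>j. \<Sum>i<dim_row A. \<bar>A $$ (i, j)\<bar>"
  let ?m = "Max (?c ` {..<dim_col A})"
  let ?q = "\<lambda>v. vec_norm1 (A *\<^sub>v v) / vec_norm1 v"
  let ?X = "carrier_vec (dim_col A) - {0\<^sub>v (dim_col A) :: real vec}"
  have "?m \<in> ?c ` {..<dim_col A}"
    using assms by (intro Max_in) auto
  then obtain j where j: "j < dim_col A" "?m = ?c j"
    by auto
  have "vec_norm1 (unit_vec (dim_col A) j) = (\<Sum>i<dim_col A. if i = j then 1 else 0)"
    using j(1) unfolding vec_norm1_def by (intro sum.cong) (auto simp: unit_vec_def)
  then have unit1: "vec_norm1 (unit_vec (dim_col A) j) = 1"
    using j(1) by simp
  have "vec_norm1 (A *\<^sub>v unit_vec (dim_col A) j) = ?c j"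
    using j(1) unfolding vec_norm1_def by (auto intro!: sum.cong)
  then have eq: "?m = ?q (unit_vec (dim_col A) j)"
    using unit1 j(2) by simp
  have "unit_vec (dim_col A) j \<in> ?X"
  proof -
    have "unit_vec (dim_col A) j $ j \<noteq> (0\<^sub>v (dim_col A) :: real vec) $ j"
      using j(1) by simp
    then have "unit_vec (dim_col A) j \<noteq> (0\<^sub>v (dim_col A) :: real vec)"
      by (rule contrapos_nn) (rule arg_cong)
    then show ?thesis
      by simp
  qed
  with eq have attained: "?m \<in> ?q ` ?X"
    by (rule image_eqI)
  have bound: "?q v \<le> ?m" if "v \<in> ?X" for v
  proof -
    have dim: "dim_vec v = dim_col A"
      using that by auto
    have nonneg: "0 \<le> vec_norm1 v"
      unfolding vec_norm1_def by (simp add: sum_nonneg)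
    have "vec_norm1 v \<noteq> 0"
    proof
      assume "vec_norm1 v = 0"
      then have "v = 0\<^sub>v (dim_col A)"
        using dim unfolding vec_norm1_def by (intro eq_vecI) (auto simp: sum_nonneg_eq_0_iff)
      then show False
        using that by simp
    qed
    then have pos: "0 < vec_norm1 v"
      using nonneg by simp
    have "vec_norm1 (A *\<^sub>v v) = (\<Sum>i<dim_row A. \<bar>\<Sum>j<dim_col A. A $$ (i, j) * v $ j\<bar>)"
      unfolding vec_norm1_def using dim
      by (auto simp: scalar_prod_def lessThan_atLeast0 intro!: sum.cong)
    also have "\<dots> \<le> (\<Sum>i<dim_row A. \<Sum>j<dim_col A. \<bar>A $$ (i, j)\<bar> * \<bar>v $ j\<bar>)"
      by (intro sum_mono order_trans[OF sum_abs]) (simp add: abs_mult)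
    also have "\<dots> = (\<Sum>j<dim_col A. ?c j * \<bar>v $ j\<bar>)"
      by (subst sum.swap) (simp add: sum_distrib_right)
    also have "\<dots> \<le> (\<Sum>j<dim_col A. ?m * \<bar>v $ j\<bar>)"
      by (intro sum_mono mult_right_mono Max_ge) auto
    also have "\<dots> = ?m * vec_norm1 v"
      unfolding vec_norm1_def dim by (simp add: sum_distrib_left)
    finally show ?thesis
      using pos by (simp add: pos_divide_le_eq)
  qed
  show ?thesis
    unfolding mat_norm1_def using attained bound by (intro cSup_eq_maximum) auto
qed

definition mat_inv :: "real mat \<Rightarrow> real mat" where
  "mat_inv A = the (mat_inverse A)"

definition left_cols :: "nat \<Rightarrow> real mat \<Rightarrow> real mat" where
  "left_cols k A = mat_of_cols (dim_row A) (take k (cols A))"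

definition right_cols :: "nat \<Rightarrow> real mat \<Rightarrow> real mat" where
  "right_cols k A = mat_of_cols (dim_row A) (drop k (cols A))"

text \<open>
  For a wide matrix, \<^const>\<open>upper_triangular\<close> (zero below the main diagonal) means
  upper trapezoidal. The library's notion of orthogonal matrix does not normalise the columns.
\<close>

definition is_QR :: "real mat \<Rightarrow> real mat \<Rightarrow> real mat \<Rightarrow> bool" where
  "is_QR A Q R \<longleftrightarrow>
     Q \<in> carrier_mat (dim_row A) (dim_row A) \<and> R \<in> carrier_mat (dim_row A) (dim_col A) \<and>
     inverts_mat (transpose_mat Q) Q \<and> inverts_mat Q (transpose_mat Q) \<and> upper_triangular R \<and> A = Q * R"


section \<open>The interpolation-regression operator\<close>

text \<open>Basis functions and points are numbered from 0.\<close>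

definition eval_mat ::
    "nat \<Rightarrow> nat \<Rightarrow> (nat \<Rightarrow> real \<times> real \<Rightarrow> real) \<Rightarrow> (nat \<Rightarrow> real \<times> real) \<Rightarrow> real mat" where
  "eval_mat N R u x = mat N R (\<lambda>(i, j). u j (x i))"

text \<open>
  The system is uniquely solvable if \<open>A\<close> has full column rank and \<open>C\<close> has full row rank.
\<close>

definition kkt_coeffs :: "real mat \<Rightarrow> real mat \<Rightarrow> real vec \<Rightarrow> real vec \<Rightarrow> real vec" where
  "kkt_coeffs A C b d = (THE a. a \<in> carrier_vec (dim_col A) \<and>
     (\<exists>z\<in>carrier_vec (dim_row C).
        four_block_mat (2 \<cdot>\<^sub>m (transpose_mat A * A)) (transpose_mat C)
                       C (0\<^sub>m (dim_row C) (dim_row C)) *\<^sub>v (a @\<^sub>v z) =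
        (2 \<cdot>\<^sub>v (transpose_mat A *\<^sub>v b)) @\<^sub>v d))"

text \<open>\<open>x\<close> lists the \<open>N\<close> sampling points, \<open>x'\<close> the \<open>M\<close> interpolation nodes.\<close>

definition interp_regr ::
    "nat \<Rightarrow> nat \<Rightarrow> nat \<Rightarrow> (nat \<Rightarrow> real \<times> real \<Rightarrow> real) \<Rightarrow> (nat \<Rightarrow> real \<times> real) \<Rightarrow>
     (nat \<Rightarrow> real \<times> real) \<Rightarrow> (real \<times> real \<Rightarrow> real) \<Rightarrow> real \<times> real \<Rightarrow> real" where
  "interp_regr N M R u x x' f =
     (let a = kkt_coeffs (eval_mat N R u x) (eval_mat M R u x')
                         (vec N (\<lambda>i. f (x i))) (vec M (\<lambda>i. f (x' i)))
      in (\<lambda>z. \<Sum>i<R. a $ i * u i z))"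

end

theory Submission
  imports Defs
begin

text \<open>
  A QR factorization of the constraint matrix solves the constraints for the leading \<open>M\<close> coefficients,
  \<open>a\<^sub>1 = R\<^sub>1\<^sub>1\<^sup>-\<^sup>1 (Q\<^sup>T d - R\<^sub>1\<^sub>2 a\<^sub>2)\<close>. The remaining coefficients \<open>a\<^sub>2\<close> solve an unconstrained least-squares
  problem with matrix \<open>V\<close>, which has full column rank because \<open>\<M>\<close> has, so that
  \<open>a\<^sub>2 = (V\<^sup>T V)\<^sup>-\<^sup>1 V\<^sup>T (b - \<M>\<^sub>1 R\<^sub>1\<^sub>1\<^sup>-\<^sup>1 Q\<^sup>T d)\<close>. If \<open>f\<close> has norm 1, then \<open>b\<close> and \<open>d\<close> have 1-norms at most
  \<open>N\<close> and \<open>M\<close>, which bounds the 1-norms of \<open>a\<^sub>2\<close> and \<open>a\<^sub>1\<close> by \<open>K2\<close> and \<open>K1\<close>.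
\<close>

text \<open>From here on \<open>\<bullet>\<close> can denote only the scalar product of vectors of
  type \<open>vec\<close>, not the inner product of a Euclidean space.\<close>

unbundle no inner_syntax

section \<open>Continuous functions on the disk\<close>

text \<open>Compactness of the disk makes the values of a continuous function bounded, so that the
  real supremum in \<open>sup_norm\<close> is a genuine upper bound.\<close>

lemma abs_le_sup_norm:
  assumes "continuous_on disk f" "z \<in> disk"
  shows "\<bar>f z\<bar> \<le> sup_norm f"
proof -
  have "compact ((\<lambda>z. \<bar>f z\<bar>) ` disk)"
    using assms(1) by (intro compact_continuous_image continuous_intros) (auto simp: disk_def)
  then have "bdd_above ((\<lambda>z. \<bar>f z\<bar>) ` disk)"
    by (simp add: bounded_imp_bdd_above compact_imp_bounded)
  then show ?thesis
    unfolding sup_norm_def using assms(2) by (intro cSUP_upper)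
qed

lemma sup_norm_le:
  assumes "\<And>z. z \<in> disk \<Longrightarrow> \<bar>f z\<bar> \<le> B"
  shows "sup_norm f \<le> B"
  unfolding sup_norm_def using assms by (intro cSUP_least) (auto simp: disk_def)

text \<open>The continuous functions form a subspace that contains the monomials, hence also their
  span. This gives the basis functions a meaningful \<open>sup_norm\<close>.\<close>

lemma continuous_on_poly_space:
  assumes "p \<in> poly_space d"
  shows "continuous_on A p"
proof -
  have "p \<in> fun_vs.span {\<lambda>(x, y). x ^ i * y ^ j | i j. i + j \<le> d}"
    using assms by (simp add: poly_space_def)
  moreover have "fun_vs.span {\<lambda>(x, y). x ^ i * y ^ j | i j. i + j \<le> d} \<subseteq> {f. continuous_on A f}"
  proof (rule fun_vs.span_minimal)
    show "{\<lambda>(x, y). x ^ i * y ^ j | i j. i + j \<le> d} \<subseteq> {f :: real \<times> real \<Rightarrow> real. continuous_on A f}"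
      by (auto simp: case_prod_unfold intro!: continuous_intros)
    show "fun_vs.subspace {f. continuous_on A f}"
      unfolding fun_vs.subspace_def plus_fun_def zero_fun_def
      by (auto intro!: continuous_intros)
  qed
  ultimately show ?thesis by blast
qed

text \<open>By monotonicity all radii lie between \<open>r 0 > 0\<close> and
  \<open>r n \<le> 1\<close>, and a point in polar form has the absolute value of its radius as
  norm.\<close>

lemma sampling_set_subset_disk:
  assumes "is_sampling_set n S"
  shows "S \<subseteq> disk"
proof
  fix z assume "z \<in> S"
  with assms obtain r \<theta> \<eta> \<kappa> where r: "0 < r 0" "strict_mono_on {..n} r" "r n \<le> 1"
    and \<eta>: "\<eta> \<le> n" and z: "z = polar (r \<eta>) (\<theta> \<kappa>)"
    unfolding is_sampling_set_def by blast
  have "r 0 \<le> r \<eta>" "r \<eta> \<le> r n"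
    using r(2) \<eta> by (auto intro: strict_mono_onD[THEN less_imp_le] simp: strict_mono_on_leD)
  then have "\<bar>r \<eta>\<bar> \<le> 1"
    using r by simp
  moreover have "norm z = \<bar>r \<eta>\<bar>"
    unfolding z polar_def norm_Pair
    by (simp add: power_mult_distrib flip: distrib_left)
  ultimately show "z \<in> disk"
    by (simp add: disk_def)
qed

text \<open>Each selected node is a minimizer over a subset of \<open>S\<close>.\<close>

lemma mock_optimal_subset:
  assumes "is_mock_optimal m S \<Sigma>"
  shows "\<Sigma> \<subseteq> S"
  using assms unfolding is_mock_optimal_def is_arg_min_def by auto

section \<open>The 1-norm\<close>

lemma vec_norm1_append: "vec_norm1 (v @\<^sub>v w) = vec_norm1 v + vec_norm1 w"
proof -
  have split: "(\<Sum>i<p + q. g i) = (\<Sum>i<p. g i) + (\<Sum>i<q. g (p + i))" for p q and g :: "nat \<Rightarrow> real"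
    by (induction q) (simp_all add: add.assoc)
  show ?thesis
    unfolding vec_norm1_def index_append_vec(2) split by simp
qed

lemma vec_norm1_diff_le:
  assumes "dim_vec v = dim_vec w"
  shows "vec_norm1 (v - w) \<le> vec_norm1 v + vec_norm1 w"
proof -
  have "vec_norm1 (v - w) = (\<Sum>i<dim_vec w. \<bar>v $ i - w $ i\<bar>)"
    by (simp add: vec_norm1_def)
  also have "\<dots> \<le> (\<Sum>i<dim_vec w. \<bar>v $ i\<bar> + \<bar>w $ i\<bar>)"
    by (intro sum_mono abs_triangle_ineq4)
  also have "\<dots> = vec_norm1 v + vec_norm1 w"
    unfolding vec_norm1_def assms by (rule sum.distrib)
  finally show ?thesis .
qed

lemma vec_norm1_le_dim:
  assumes "\<And>i. i < k \<Longrightarrow> \<bar>f i\<bar> \<le> 1"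
  shows "vec_norm1 (vec k f) \<le> real k"
  using sum_bounded_above[of "{..<k}" "\<lambda>i. \<bar>f i\<bar>" 1] assms
  by (simp add: vec_norm1_def)

text \<open>The norm dominates the absolute sum of column 0. Without any column, the supremum
  defining \<open>mat_norm1\<close> would range over the empty set and be unspecified.\<close>

lemma mat_norm1_nonneg:
  assumes "0 < dim_col A"
  shows "0 \<le> mat_norm1 A"
proof -
  have "(\<Sum>i<dim_row A. \<bar>A $$ (i, 0)\<bar>) \<le> mat_norm1 A"
    unfolding mat_norm1_eq_max_col_sum[OF assms] using assms by (intro Max_ge) auto
  then show ?thesis
    by (rule order_trans[rotated]) (simp add: sum_nonneg)
qed

text \<open>Passing through the maximal column sum instead of the defining supremum also covers
  \<open>v = 0\<close>, which is excluded from the quotients in that supremum.\<close>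

lemma vec_norm1_mult_mat_vec_le:
  assumes A: "A \<in> carrier_mat k l" and v: "v \<in> carrier_vec l" and l: "0 < l"
  shows "vec_norm1 (A *\<^sub>v v) \<le> mat_norm1 A * vec_norm1 v"
proof -
  have "vec_norm1 (A *\<^sub>v v) = (\<Sum>i<k. \<bar>\<Sum>j<l. A $$ (i, j) * v $ j\<bar>)"
    unfolding vec_norm1_def using A v
    by (auto simp: scalar_prod_def lessThan_atLeast0 intro!: sum.cong)
  also have "\<dots> \<le> (\<Sum>i<k. \<Sum>j<l. \<bar>A $$ (i, j)\<bar> * \<bar>v $ j\<bar>)"
    by (intro sum_mono order_trans[OF sum_abs]) (simp add: abs_mult)
  also have "\<dots> = (\<Sum>j<l. (\<Sum>i<k. \<bar>A $$ (i, j)\<bar>) * \<bar>v $ j\<bar>)"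
    by (subst sum.swap) (simp add: sum_distrib_right)
  also have "\<dots> \<le> (\<Sum>j<l. mat_norm1 A * \<bar>v $ j\<bar>)"
    using A l by (intro sum_mono mult_right_mono) (auto simp: mat_norm1_eq_max_col_sum)
  also have "\<dots> = mat_norm1 A * vec_norm1 v"
    using v by (simp add: vec_norm1_def sum_distrib_left)
  finally show ?thesis .
qed

text \<open>Hoelder's inequality, pairing the 1-norm of the coefficients with the maximum of the sup
  norms of the functions.\<close>

lemma abs_lincomb_le:
  assumes a: "a \<in> carrier_vec k" and z: "z \<in> disk"
    and cont: "\<And>i. i < k \<Longrightarrow> continuous_on disk (u i)"
  shows "\<bar>\<Sum>i<k. a $ i * u i z\<bar> \<le> Max ((\<lambda>i. sup_norm (u i)) ` {..<k}) * vec_norm1 a"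
proof -
  have "\<bar>\<Sum>i<k. a $ i * u i z\<bar> \<le> (\<Sum>i<k. \<bar>a $ i\<bar> * \<bar>u i z\<bar>)"
    by (rule order_trans[OF sum_abs]) (simp add: abs_mult)
  also have "\<dots> \<le> (\<Sum>i<k. \<bar>a $ i\<bar> * Max ((\<lambda>i. sup_norm (u i)) ` {..<k}))"
  proof (intro sum_mono mult_left_mono)
    fix i assume "i \<in> {..<k}"
    then have "\<bar>u i z\<bar> \<le> sup_norm (u i)" "sup_norm (u i) \<le> Max ((\<lambda>i. sup_norm (u i)) ` {..<k})"
      using abs_le_sup_norm[OF cont z] by auto
    then show "\<bar>u i z\<bar> \<le> Max ((\<lambda>i. sup_norm (u i)) ` {..<k})"
      by simp
  qed simp
  also have "\<dots> = Max ((\<lambda>i. sup_norm (u i)) ` {..<k}) * vec_norm1 a"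
    using a by (simp add: vec_norm1_def mult.commute flip: sum_distrib_right)
  finally show ?thesis .
qed

section \<open>Matrices of full rank\<close>

text \<open>An invertible matrix is a unit of the matrix ring, and for units Gauss-Jordan
  elimination returns a two-sided inverse.\<close>

lemma mat_inv_correct:
  assumes A: "A \<in> carrier_mat k k" and "invertible_mat A"
  shows "mat_inv A \<in> carrier_mat k k" "A * mat_inv A = 1\<^sub>m k" "mat_inv A * A = 1\<^sub>m k"
proof -
  obtain B where B: "A * B = 1\<^sub>m k" "B * A = 1\<^sub>m (dim_row B)"
    using assms by (auto simp: invertible_mat_def inverts_mat_def)
  \<comment> \<open>Comparing dimensions in both products forces \<open>B\<close> to be square of
    size \<open>k\<close>.\<close>
  have "dim_col (A * B) = k" "dim_col (B * A) = dim_row B"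
    unfolding B by simp_all
  then have "B \<in> carrier_mat k k"
    using A by auto
  then have "A \<in> Units (ring_mat TYPE(real) k ())"
    using A B unfolding Units_def ring_mat_def by auto
  then obtain B' where "mat_inverse A = Some B'"
    using mat_inverse(1)[OF A, of "()"] by (cases "mat_inverse A") auto
  then show "mat_inv A \<in> carrier_mat k k" "A * mat_inv A = 1\<^sub>m k" "mat_inv A * A = 1\<^sub>m k"
    using mat_inverse(2)[OF A] by (auto simp: mat_inv_def)
qed

text \<open>Over a field, a vanishing determinant yields a nonzero vector in the kernel.\<close>

lemma invertible_mat_if_kernel_trivial:
  fixes A :: "real mat"
  assumes A: "A \<in> carrier_mat k k"
    and ker: "\<And>v. v \<in> carrier_vec k \<Longrightarrow> A *\<^sub>v v = 0\<^sub>v k \<Longrightarrow> v = 0\<^sub>v k"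
  shows "invertible_mat A"
proof -
  have "det A \<noteq> 0"
    using ker det_0_iff_vec_prod_zero_field[OF A] by blast
  then have "A \<in> Units (ring_mat TYPE(real) k ())"
    by (rule det_non_zero_imp_unit[OF A])
  then show ?thesis
    using A unfolding Units_def ring_mat_def invertible_mat_def inverts_mat_def by auto
qed

text \<open>The rank is the size of a maximal independent set of columns, and a repeated column
  would leave fewer than \<open>nc\<close> elements to choose from. Linear independence is a
  property of the set of columns, so repetitions have to be excluded separately.\<close>

lemma (in vec_space) full_rank_distinct_cols:
  assumes A: "A \<in> carrier_mat n nc" and "rank A = nc"
  shows "distinct (cols A)"
proof -
  have "\<exists>S. maximal S (\<lambda>T. T \<subseteq> set (cols A) \<and> lin_indpt T)"
    using maximal_exists[of "(\<lambda>T. T \<subseteq> set (cols A) \<and> lin_indpt T)" "card (set (cols A))" "{}"]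
    by (meson List.finite_set card_mono empty_iff empty_subsetI finite_lin_indpt2 rev_finite_subset)
  then obtain S where S: "maximal S (\<lambda>T. T \<subseteq> set (cols A) \<and> lin_indpt T)" ..
  have "card S = nc"
    using rank_card_indpt[OF A S] assms(2) by simp
  moreover have "card S \<le> card (set (cols A))"
    using S by (simp add: card_mono maximal_def)
  moreover have "length (cols A) = nc"
    using A by simp
  ultimately show ?thesis
    using card_length[of "cols A"] by (intro card_distinct) simp
qed

text \<open>A nonzero vector in the kernel would be a linear dependence among the columns, which are
  distinct and independent.\<close>

lemma (in vec_space) full_rank_kernel_trivial:
  assumes A: "A \<in> carrier_mat n nc" and rk: "rank A = nc"
    and v: "v \<in> carrier_vec nc" "A *\<^sub>v v = 0\<^sub>v n"
  shows "v = 0\<^sub>v nc"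
  using full_rank_lin_indpt[OF A rk] full_rank_distinct_cols[OF A rk] lin_depI[OF A v(1) _ v(2)]
  by blast

lemma diff_add_eq_diff_diff_vec:
  fixes u v w :: "real vec"
  assumes "u \<in> carrier_vec k" "v \<in> carrier_vec k" "w \<in> carrier_vec k"
  shows "u - (v + w) = u - v - w"
  using assms by (intro eq_vecI) auto

lemma add_diff_cancel_left_vec:
  fixes u v :: "real vec"
  assumes "u \<in> carrier_vec k" "v \<in> carrier_vec k"
  shows "u + v - u = v"
  using assms by (intro eq_vecI) auto

lemma mult_mat_zero_vec:
  assumes "A \<in> carrier_mat k l"
  shows "A *\<^sub>v 0\<^sub>v l = 0\<^sub>v k"
  using assms by (intro eq_vecI) auto

lemma zero_mat_mult_vec:
  assumes "v \<in> carrier_vec l"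
  shows "0\<^sub>m k l *\<^sub>v v = 0\<^sub>v k"
  using assms by (intro eq_vecI) auto

lemma scalar_prod_self_eq_0:
  fixes v :: "real vec"
  assumes "v \<in> carrier_vec k" "v \<bullet> v = 0"
  shows "v = 0\<^sub>v k"
proof -
  have "(\<Sum>i<k. v $ i * v $ i) = 0"
    using assms by (simp add: scalar_prod_def lessThan_atLeast0)
  then have "\<forall>i<k. v $ i = 0"
    by (subst (asm) sum_nonneg_eq_0_iff) auto
  with assms(1) show ?thesis
    by (intro eq_vecI) auto
qed

text \<open>If the Gram matrix annihilates \<open>y\<close>, then the scalar product of
  \<open>V y\<close> with itself is 0, so \<open>V y = 0\<close>.\<close>

lemma invertible_gram_mat:
  fixes V :: "real mat"
  assumes V: "V \<in> carrier_mat k l"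
    and ker: "\<And>y. y \<in> carrier_vec l \<Longrightarrow> V *\<^sub>v y = 0\<^sub>v k \<Longrightarrow> y = 0\<^sub>v l"
  shows "invertible_mat (transpose_mat V * V)"
proof (rule invertible_mat_if_kernel_trivial)
  show "transpose_mat V * V \<in> carrier_mat l l"
    using V by simp
next
  fix y assume y: "y \<in> carrier_vec l" and "(transpose_mat V * V) *\<^sub>v y = 0\<^sub>v l"
  then have "transpose_mat V *\<^sub>v (V *\<^sub>v y) = 0\<^sub>v l"
    using V by (simp add: assoc_mult_mat_vec[of _ l k])
  moreover have "(transpose_mat V *\<^sub>v (V *\<^sub>v y)) \<bullet> y = (V *\<^sub>v y) \<bullet> (V *\<^sub>v y)"
    using V y by (intro transpose_vec_mult_scalar[OF V y] mult_mat_vec_carrier)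
  ultimately have "(V *\<^sub>v y) \<bullet> (V *\<^sub>v y) = 0"
    using y by simp
  then have "V *\<^sub>v y = 0\<^sub>v k"
    by (rule scalar_prod_self_eq_0[OF mult_mat_vec_carrier[OF V y]])
  then show "y = 0\<^sub>v l"
    by (rule ker[OF y])
qed

section \<open>Column blocks\<close>

lemma left_cols_carrier: "A \<in> carrier_mat k l \<Longrightarrow> p \<le> l \<Longrightarrow> left_cols p A \<in> carrier_mat k p"
  by (intro carrier_matI) (simp_all add: left_cols_def)

lemma right_cols_carrier:
  "A \<in> carrier_mat k (p + l) \<Longrightarrow> right_cols p A \<in> carrier_mat k l"
  by (intro carrier_matI) (simp_all add: right_cols_def)

lemma left_cols_index:
  "i < dim_row A \<Longrightarrow> j < p \<Longrightarrow> p \<le> dim_col A \<Longrightarrow> left_cols p A $$ (i, j) = A $$ (i, j)"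
  by (simp add: left_cols_def mat_of_cols_index)

lemma right_cols_index:
  "i < dim_row A \<Longrightarrow> p + j < dim_col A \<Longrightarrow> right_cols p A $$ (i, j) = A $$ (i, p + j)"
  by (simp add: right_cols_def mat_of_cols_index)

text \<open>Column \<open>j\<close> of a product depends only on column \<open>j\<close> of the
  right factor. In this way the QR factorization passes to the column blocks.\<close>

lemma left_cols_mult:
  assumes "A \<in> carrier_mat k n" "B \<in> carrier_mat n l" "p \<le> l"
  shows "left_cols p (A * B) = A * left_cols p B"
  using assms left_cols_carrier[of "A * B" k l p] left_cols_carrier[of B n l p]
  by (intro eq_matI) (auto simp: left_cols_index scalar_prod_def)

lemma right_cols_mult:
  assumes "A \<in> carrier_mat k n" "B \<in> carrier_mat n (p + l)"
  shows "right_cols p (A * B) = A * right_cols p B"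
  using assms right_cols_carrier[of "A * B" k p l] right_cols_carrier[of B n p l]
  by (intro eq_matI) (auto simp: right_cols_index scalar_prod_def)

text \<open>Lower blocks without rows let \<open>four_block_mat\<close> express two blocks side by
  side, so that its product rule becomes available.\<close>

lemma split_cols:
  assumes A: "A \<in> carrier_mat k (p + l)"
  shows "A = four_block_mat (left_cols p A) (right_cols p A) (0\<^sub>m 0 p) (0\<^sub>m 0 l)"
  using A left_cols_carrier[OF A, of p] right_cols_carrier[OF A]
  by (intro eq_matI) (auto simp: left_cols_index right_cols_index)

text \<open>The product of a block row with a block column, read off from the four-block product
  with empty blocks as padding.\<close>

lemma mult_append_rows:
  fixes A :: "real mat"
  assumes A: "A \<in> carrier_mat k (p + l)"
    and B: "B \<in> carrier_mat p q" and D: "D \<in> carrier_mat l q"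
  shows "A * (B @\<^sub>r D) = left_cols p A * B + right_cols p A * D"
proof -
  have L: "left_cols p A \<in> carrier_mat k p" and R: "right_cols p A \<in> carrier_mat k l"
    using left_cols_carrier[OF A] right_cols_carrier[OF A] by auto
  have "A * (B @\<^sub>r D) = four_block_mat (left_cols p A) (right_cols p A) (0\<^sub>m 0 p) (0\<^sub>m 0 l) *
      four_block_mat B (0\<^sub>m p 0) D (0\<^sub>m l 0)"
    using B D by (subst split_cols[OF A]) (simp add: append_rows_def)
  also have "\<dots> = left_cols p A * B + right_cols p A * D"
    using L R B D
    by (subst mult_four_block_mat[OF L R _ _ B _ D]) (auto intro!: eq_matI)
  finally show ?thesis .
qed

text \<open>The product of a block column with a block row. The padding has inner dimension 0 and
  contributes only zero summands.\<close>

lemma append_rows_mult: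
  fixes B :: "real mat"
  assumes B: "B \<in> carrier_mat p n" and D: "D \<in> carrier_mat q n"
    and A1: "A1 \<in> carrier_mat n k" and A2: "A2 \<in> carrier_mat n l"
  shows "(B @\<^sub>r D) * four_block_mat A1 A2 (0\<^sub>m 0 k) (0\<^sub>m 0 l) =
    four_block_mat (B * A1) (B * A2) (D * A1) (D * A2)"
proof -
  have "B @\<^sub>r D = four_block_mat B (0\<^sub>m p 0) D (0\<^sub>m q 0)"
    using B D by (simp add: append_rows_def)
  then show ?thesis
    using B D A1 A2
    by (simp add: mult_four_block_mat[OF B _ D _ A1 A2, of "0\<^sub>m p 0" 0 "0\<^sub>m q 0"])
qed

section \<open>The KKT system\<close>

text \<open>
  The null-space method: \<open>G\<close> is a right inverse of the constraint matrix \<open>C\<close> and the columns of \<open>T\<close>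
  span the kernel of \<open>C\<close>, so that the constrained problem becomes an unconstrained one for the
  coordinates with respect to these columns, which \<open>E\<close> extracts.
\<close>

lemma kkt_coeffs_null_space:
  assumes A: "A \<in> carrier_mat N R" and C: "C \<in> carrier_mat M R"
    and G: "G \<in> carrier_mat R M" and T: "T \<in> carrier_mat R L" and E: "E \<in> carrier_mat L R"
    and CG: "C * G = 1\<^sub>m M" and CT: "C * T = 0\<^sub>m M L" and ET: "E * T = 1\<^sub>m L"
    and decomp: "G * C + T * E = 1\<^sub>m R"
    and ker: "\<And>a. a \<in> carrier_vec R \<Longrightarrow> A *\<^sub>v a = 0\<^sub>v N \<Longrightarrow> a = 0\<^sub>v R"
    and b: "b \<in> carrier_vec N" and d: "d \<in> carrier_vec M"
    and V_eq: "V = A * T"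
  shows "mat_inv (transpose_mat V * V) \<in> carrier_mat L L"
    and "kkt_coeffs A C b d =
    G *\<^sub>v d + T *\<^sub>v ((mat_inv (transpose_mat V * V) * transpose_mat V) *\<^sub>v (b - A *\<^sub>v (G *\<^sub>v d)))"
proof -

  \<comment> \<open>The reduced least-squares problem\<close>
  let ?V' = "transpose_mat V" and ?A' = "transpose_mat A" and ?C' = "transpose_mat C"
  let ?T' = "transpose_mat T"
  define J where "J = mat_inv (?V' * V)"
  define h where "h = b - A *\<^sub>v (G *\<^sub>v d)"
  define y where "y = (J * ?V') *\<^sub>v h"
  define a where "a = G *\<^sub>v d + T *\<^sub>v y"
  have V: "V \<in> carrier_mat N L"
    unfolding V_eq using A T by simp
  have V': "?V' \<in> carrier_mat L N" and A': "?A' \<in> carrier_mat R N"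
    and C': "?C' \<in> carrier_mat R M" and T': "?T' \<in> carrier_mat L R"
    using V A C T by auto
  have V'_eq: "?V' = ?T' * ?A'"
    unfolding V_eq by (rule transpose_mult[OF A T])
  \<comment> \<open>\<open>V\<close> inherits the trivial kernel of \<open>A\<close>: from
    \<open>A (T y) = 0\<close> follows \<open>T y = 0\<close>, and the left inverse \<open>E\<close>
    of \<open>T\<close> then gives \<open>y = 0\<close>.\<close>
  have "invertible_mat (?V' * V)"
  proof (rule invertible_gram_mat[OF V])
    fix y assume y: "y \<in> carrier_vec L" and "V *\<^sub>v y = 0\<^sub>v N"
    then have "A *\<^sub>v (T *\<^sub>v y) = 0\<^sub>v N"
      using assoc_mult_mat_vec[OF A T y] by (simp add: V_eq)
    then have "T *\<^sub>v y = 0\<^sub>v R"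
      using T y by (intro ker) auto
    then have "(E * T) *\<^sub>v y = E *\<^sub>v 0\<^sub>v R"
      by (simp add: assoc_mult_mat_vec[OF E T y])
    also have "\<dots> = 0\<^sub>v L"
      by (rule mult_mat_zero_vec[OF E])
    finally have "(E * T) *\<^sub>v y = 0\<^sub>v L" .
    then show "y = 0\<^sub>v L"
      using y by (simp add: ET)
  qed
  then have J: "J \<in> carrier_mat L L" "?V' * V * J = 1\<^sub>m L" "J * (?V' * V) = 1\<^sub>m L"
    using mat_inv_correct[of "?V' * V" L] V V' unfolding J_def by auto
  show "mat_inv (?V' * V) \<in> carrier_mat L L"
    using J(1) by (simp add: J_def)
  have Gd: "G *\<^sub>v d \<in> carrier_vec R"
    using G d by simp
  have AGd: "A *\<^sub>v (G *\<^sub>v d) \<in> carrier_vec N"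
    using A Gd by simp
  have h: "h \<in> carrier_vec N"
    unfolding h_def using b AGd by simp
  have V'h: "?V' *\<^sub>v h \<in> carrier_vec L"
    using V' h by simp
  have y_eq: "y = J *\<^sub>v (?V' *\<^sub>v h)"
    unfolding y_def by (rule assoc_mult_mat_vec[OF J(1) V' h])
  have y: "y \<in> carrier_vec L"
    unfolding y_eq using J(1) V'h by simp
  have Ty: "T *\<^sub>v y \<in> carrier_vec R"
    using T y by simp
  have a: "a \<in> carrier_vec R"
    unfolding a_def using Gd Ty by simp
  \<comment> \<open>Along the feasible vectors \<open>G d + T w\<close> the residual is
    \<open>h - V w\<close>, so minimizing over \<open>w\<close> is unconstrained.\<close>
  have A_param: "A *\<^sub>v (G *\<^sub>v d + T *\<^sub>v w) = A *\<^sub>v (G *\<^sub>v d) + V *\<^sub>v w"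
    if w: "w \<in> carrier_vec L" for w
    using mult_add_distrib_mat_vec[OF A Gd, of "T *\<^sub>v w"] assoc_mult_mat_vec[OF A T w] T w
    by (simp add: V_eq)
  \<comment> \<open>The constraint values determine the first summand; \<open>E v\<close> are the
    coordinates of the second one in the kernel of \<open>C\<close>. This parametrizes an arbitrary
    solution in the uniqueness argument.\<close>
  have decomp_vec: "v = G *\<^sub>v (C *\<^sub>v v) + T *\<^sub>v (E *\<^sub>v v)" if v: "v \<in> carrier_vec R" for v
  proof -
    have "v = (G * C + T * E) *\<^sub>v v"
      using v by (simp add: decomp)
    also have "\<dots> = (G * C) *\<^sub>v v + (T * E) *\<^sub>v v"
      using G C T E v by (intro add_mult_distrib_mat_vec) auto
    also have "\<dots> = G *\<^sub>v (C *\<^sub>v v) + T *\<^sub>v (E *\<^sub>v v)"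
      by (simp add: assoc_mult_mat_vec[OF G C v] assoc_mult_mat_vec[OF T E v])
    finally show ?thesis .
  qed

  \<comment> \<open>Feasibility of the candidate and its multiplier\<close>
  have Ca: "C *\<^sub>v a = d"
  proof -
    have "C *\<^sub>v a = (C * G) *\<^sub>v d + (C * T) *\<^sub>v y"
      unfolding a_def mult_add_distrib_mat_vec[OF C Gd Ty]
      by (simp add: assoc_mult_mat_vec[OF C G d] assoc_mult_mat_vec[OF C T y])
    then show ?thesis
      using d y by (simp add: CG CT zero_mat_mult_vec)
  qed
  define e where "e = b - A *\<^sub>v a"
  have e: "e \<in> carrier_vec N"
    unfolding e_def using A a b by simp
  have Vy: "V *\<^sub>v y \<in> carrier_vec N"
    using V y by simp
  \<comment> \<open>The normal equations of the reduced problem: the residual of the candidate is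
    orthogonal to the range of \<open>V\<close>.\<close>
  have V'e: "?V' *\<^sub>v e = 0\<^sub>v L"
  proof -
    have "e = h - V *\<^sub>v y"
      unfolding e_def a_def A_param[OF y] h_def by (rule diff_add_eq_diff_diff_vec[OF b AGd Vy])
    then have "?V' *\<^sub>v e = ?V' *\<^sub>v h - ?V' *\<^sub>v (V *\<^sub>v y)"
      using mult_minus_distrib_mat_vec[OF V' h Vy] by simp
    also have "?V' *\<^sub>v (V *\<^sub>v y) = (?V' * V) *\<^sub>v y"
      by (rule assoc_mult_mat_vec[OF V' V y, symmetric])
    also have "\<dots> = (?V' * V * J) *\<^sub>v (?V' *\<^sub>v h)"
      unfolding y_eq using assoc_mult_mat_vec[OF _ J(1) V'h, of "?V' * V" L] V V' by simp
    also have "\<dots> = ?V' *\<^sub>v h"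
      using V'h by (simp add: J(2))
    finally show ?thesis
      using V'h by simp
  qed
  \<comment> \<open>\<open>2 w\<close> is the negative gradient of the squared residual norm at
    \<open>a\<close>. It is orthogonal to the kernel of \<open>C\<close> because
    \<open>?T' w = ?V' e = 0\<close>.\<close>
  define w where "w = ?A' *\<^sub>v e"
  have w: "w \<in> carrier_vec R"
    unfolding w_def using A' e by simp
  have T'w: "?T' *\<^sub>v w = 0\<^sub>v L"
    using V'e unfolding w_def V'_eq by (simp add: assoc_mult_mat_vec[OF T' A' e])
  \<comment> \<open>Transposing \<open>G * C + T * E = 1\<close> and applying it to \<open>w\<close>
    leaves only the part in the range of \<open>?C'\<close>, since \<open>?T'\<close> annihilates
    \<open>w\<close>. Hence the transpose of \<open>G\<close>, applied to \<open>2 w\<close>, is a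
    multiplier.\<close>
  define z where "z = transpose_mat G *\<^sub>v (2 \<cdot>\<^sub>v w)"
  have z: "z \<in> carrier_vec M"
    unfolding z_def using G w by simp
  have C'z: "?C' *\<^sub>v z = 2 \<cdot>\<^sub>v w"
  proof -
    let ?G' = "transpose_mat G" and ?E' = "transpose_mat E"
    have G': "?G' \<in> carrier_mat M R" and E': "?E' \<in> carrier_mat R L"
      using G E by auto
    have "1\<^sub>m R = transpose_mat (G * C + T * E)"
      by (simp add: decomp)
    also have "\<dots> = transpose_mat (G * C) + transpose_mat (T * E)"
      using G C T E by (intro transpose_add) auto
    also have "\<dots> = ?C' * ?G' + ?E' * ?T'"
      by (simp add: transpose_mult[OF G C] transpose_mult[OF T E])
    finally have "w = (?C' * ?G' + ?E' * ?T') *\<^sub>v w"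
      using w by (metis one_mult_mat_vec)
    also have "\<dots> = (?C' * ?G') *\<^sub>v w + (?E' * ?T') *\<^sub>v w"
      using G' C' T' E' w by (intro add_mult_distrib_mat_vec) auto
    also have "\<dots> = ?C' *\<^sub>v (?G' *\<^sub>v w) + ?E' *\<^sub>v (?T' *\<^sub>v w)"
      by (simp add: assoc_mult_mat_vec[OF C' G' w] assoc_mult_mat_vec[OF E' T' w])
    also have "\<dots> = ?C' *\<^sub>v (?G' *\<^sub>v w)"
      using C' G' w unfolding T'w mult_mat_zero_vec[OF E'] by simp
    finally have "?C' *\<^sub>v (?G' *\<^sub>v w) = w" ..
    then show ?thesis
      unfolding z_def using C' G' w by (simp add: mult_mat_vec[of _ M R] mult_mat_vec[of _ R M])
  qed

  \<comment> \<open>The KKT system as stationarity and feasibility\<close>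
  have gram: "?A' *\<^sub>v (A *\<^sub>v v) = (?A' * A) *\<^sub>v v" if "v \<in> carrier_vec R" for v
    using assoc_mult_mat_vec[OF A' A that] by simp
  have kkt_iff: "four_block_mat (2 \<cdot>\<^sub>m (?A' * A)) ?C' C (0\<^sub>m (dim_row C) (dim_row C)) *\<^sub>v (v @\<^sub>v s) =
      (2 \<cdot>\<^sub>v (?A' *\<^sub>v b)) @\<^sub>v d \<longleftrightarrow>
      2 \<cdot>\<^sub>v (?A' *\<^sub>v (A *\<^sub>v v)) + ?C' *\<^sub>v s = 2 \<cdot>\<^sub>v (?A' *\<^sub>v b) \<and> C *\<^sub>v v = d"
    if v: "v \<in> carrier_vec R" and s: "s \<in> carrier_vec M" for v s
  proof -
    have AA: "?A' * A \<in> carrier_mat R R"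
      using A A' by simp
    have "four_block_mat (2 \<cdot>\<^sub>m (?A' * A)) ?C' C (0\<^sub>m (dim_row C) (dim_row C)) *\<^sub>v (v @\<^sub>v s) =
        ((2 \<cdot>\<^sub>m (?A' * A)) *\<^sub>v v + ?C' *\<^sub>v s) @\<^sub>v (C *\<^sub>v v + 0\<^sub>m M M *\<^sub>v s)"
      using four_block_mat_mult_vec[OF _ C' C _ v s, of "2 \<cdot>\<^sub>m (?A' * A)" "0\<^sub>m M M"] AA C by simp
    also have "(2 \<cdot>\<^sub>m (?A' * A)) *\<^sub>v v = 2 \<cdot>\<^sub>v (?A' *\<^sub>v (A *\<^sub>v v))"
      unfolding gram[OF v] using AA v by (intro eq_vecI) auto
    also have "C *\<^sub>v v + 0\<^sub>m M M *\<^sub>v s = C *\<^sub>v v"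
      using C v s by (simp add: zero_mat_mult_vec)
    finally have *: "four_block_mat (2 \<cdot>\<^sub>m (?A' * A)) ?C' C (0\<^sub>m (dim_row C) (dim_row C)) *\<^sub>v (v @\<^sub>v s) =
        (2 \<cdot>\<^sub>v (?A' *\<^sub>v (A *\<^sub>v v)) + ?C' *\<^sub>v s) @\<^sub>v (C *\<^sub>v v)" .
    have "2 \<cdot>\<^sub>v (?A' *\<^sub>v (A *\<^sub>v v)) + ?C' *\<^sub>v s \<in> carrier_vec R" "2 \<cdot>\<^sub>v (?A' *\<^sub>v b) \<in> carrier_vec R"
      using A A' C' v s b
      by (auto intro!: add_carrier_vec smult_carrier_vec[THEN iffD2] mult_mat_vec_carrier)
    then show ?thesis
      unfolding * by (rule append_vec_eq)
  qed
  have w_eq: "w = ?A' *\<^sub>v b - ?A' *\<^sub>v (A *\<^sub>v a)"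
    unfolding w_def e_def using A A' a b by (intro mult_minus_distrib_mat_vec) auto
  have "kkt_coeffs A C b d = a"
    unfolding kkt_coeffs_def
  proof (rule the_equality)
    have "2 \<cdot>\<^sub>v (?A' *\<^sub>v (A *\<^sub>v a)) + ?C' *\<^sub>v z = 2 \<cdot>\<^sub>v (?A' *\<^sub>v b)"
      unfolding C'z w_eq using A by (intro eq_vecI) (auto simp: algebra_simps)
    then show "a \<in> carrier_vec (dim_col A) \<and> (\<exists>z\<in>carrier_vec (dim_row C).
        four_block_mat (2 \<cdot>\<^sub>m (?A' * A)) ?C' C (0\<^sub>m (dim_row C) (dim_row C)) *\<^sub>v (a @\<^sub>v z) =
        (2 \<cdot>\<^sub>v (?A' *\<^sub>v b)) @\<^sub>v d)"
      using kkt_iff[OF a z] Ca a z A C by auto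
  next

    \<comment> \<open>Uniqueness of the solution\<close>
    fix v assume asm: "v \<in> carrier_vec (dim_col A) \<and> (\<exists>z\<in>carrier_vec (dim_row C).
        four_block_mat (2 \<cdot>\<^sub>m (?A' * A)) ?C' C (0\<^sub>m (dim_row C) (dim_row C)) *\<^sub>v (v @\<^sub>v z) =
        (2 \<cdot>\<^sub>v (?A' *\<^sub>v b)) @\<^sub>v d)"
    have v: "v \<in> carrier_vec R"
      using asm A by simp
    obtain s where s: "s \<in> carrier_vec M"
      and stat: "2 \<cdot>\<^sub>v (?A' *\<^sub>v (A *\<^sub>v v)) + ?C' *\<^sub>v s = 2 \<cdot>\<^sub>v (?A' *\<^sub>v b)" and Cv: "C *\<^sub>v v = d"
      using asm kkt_iff[OF v] C by auto
    define q where "q = E *\<^sub>v v"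
    have q: "q \<in> carrier_vec L"
      unfolding q_def using E v by simp
    have v_eq: "v = G *\<^sub>v d + T *\<^sub>v q"
      using decomp_vec[OF v] unfolding Cv q_def .
    have Av: "A *\<^sub>v v \<in> carrier_vec N" and Vq: "V *\<^sub>v q \<in> carrier_vec N"
      using A v V q by auto
    \<comment> \<open>Since \<open>C * T = 0\<close>, multiplying the stationarity equation by
      \<open>?T'\<close> removes the unknown multiplier \<open>s\<close> and leaves normal equations
      for \<open>v\<close>.\<close>
    have "?T' *\<^sub>v (?C' *\<^sub>v s) = transpose_mat (C * T) *\<^sub>v s"
      using assoc_mult_mat_vec[OF T' C' s] by (simp add: transpose_mult[OF C T])
    also have "\<dots> = 0\<^sub>v L"
      using s by (simp add: CT zero_mat_mult_vec)
    finally have T'C's: "?T' *\<^sub>v (?C' *\<^sub>v s) = 0\<^sub>v L" .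
    have "?T' *\<^sub>v (2 \<cdot>\<^sub>v (?A' *\<^sub>v (A *\<^sub>v v)) + ?C' *\<^sub>v s) =
        2 \<cdot>\<^sub>v (?T' *\<^sub>v (?A' *\<^sub>v (A *\<^sub>v v))) + 0\<^sub>v L"
      using mult_add_distrib_mat_vec[OF T', of "2 \<cdot>\<^sub>v (?A' *\<^sub>v (A *\<^sub>v v))" "?C' *\<^sub>v s"]
        A' Av C' s mult_mat_vec[OF T', of "?A' *\<^sub>v (A *\<^sub>v v)" 2] by (simp add: T'C's)
    then have "2 \<cdot>\<^sub>v (?V' *\<^sub>v (A *\<^sub>v v)) = 2 \<cdot>\<^sub>v (?V' *\<^sub>v b)"
      unfolding stat V'_eq
      using mult_mat_vec[OF T', of "?A' *\<^sub>v b" 2] T' A' Av b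
      by (simp add: assoc_mult_mat_vec[OF T' A' Av] assoc_mult_mat_vec[OF T' A' b])
    then have "(1 / 2) \<cdot>\<^sub>v (2 \<cdot>\<^sub>v (?V' *\<^sub>v (A *\<^sub>v v))) = (1 / 2) \<cdot>\<^sub>v (2 \<cdot>\<^sub>v (?V' *\<^sub>v b))"
      by simp
    then have normal: "?V' *\<^sub>v (A *\<^sub>v v) = ?V' *\<^sub>v b"
      by (simp add: smult_smult_assoc)
    \<comment> \<open>The coordinates \<open>q\<close> solve the same normal equations as
      \<open>y\<close>; the left inverse \<open>J\<close> of the Gram matrix then identifies the
      two.\<close>
    have "?V' *\<^sub>v h = ?V' *\<^sub>v (V *\<^sub>v q)"
    proof -
      have "?V' *\<^sub>v h = ?V' *\<^sub>v (A *\<^sub>v v) - ?V' *\<^sub>v (A *\<^sub>v (G *\<^sub>v d))"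
        unfolding h_def mult_minus_distrib_mat_vec[OF V' b AGd] normal ..
      also have "\<dots> = ?V' *\<^sub>v (A *\<^sub>v v - A *\<^sub>v (G *\<^sub>v d))"
        by (rule mult_minus_distrib_mat_vec[OF V' Av AGd, symmetric])
      also have "A *\<^sub>v v - A *\<^sub>v (G *\<^sub>v d) = V *\<^sub>v q"
        unfolding v_eq A_param[OF q] by (rule add_diff_cancel_left_vec[OF AGd Vq])
      finally show ?thesis .
    qed
    then have "y = (J * (?V' * V)) *\<^sub>v q"
      unfolding y_eq using assoc_mult_mat_vec[OF V' V q] assoc_mult_mat_vec[OF J(1) _ q, of "?V' * V"] V V'
      by simp
    then have "y = q"
      using q by (simp add: J(3))
    then show "v = a"
      unfolding v_eq a_def by simp
  qed
  then show "kkt_coeffs A C b d =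
      G *\<^sub>v d + T *\<^sub>v ((mat_inv (?V' * V) * ?V') *\<^sub>v (b - A *\<^sub>v (G *\<^sub>v d)))"
    unfolding a_def y_def J_def h_def .
qed

text \<open>With an invertible leading block of \<open>C\<close>, the trailing \<open>L\<close>
  coefficients are free and determine the leading ones. The null-space method then applies with
  explicit block matrices, and the reduced matrix \<open>A * T\<close> becomes
  \<open>V\<close>.\<close>

lemma kkt_coeffs_blocks:
  assumes A: "A \<in> carrier_mat N (M + L)" and C: "C \<in> carrier_mat M (M + L)"
    and B: "B \<in> carrier_mat M M" and BC: "B * left_cols M C = 1\<^sub>m M" and CB: "left_cols M C * B = 1\<^sub>m M"
    and ker: "\<And>a. a \<in> carrier_vec (M + L) \<Longrightarrow> A *\<^sub>v a = 0\<^sub>v N \<Longrightarrow> a = 0\<^sub>v (M + L)"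
    and b: "b \<in> carrier_vec N" and d: "d \<in> carrier_vec M"
    and Z_eq: "Z = B * right_cols M C"
    and V_eq: "V = right_cols M A - left_cols M A * Z"
    and y_eq: "y = (mat_inv (transpose_mat V * V) * transpose_mat V) *\<^sub>v
                     (b - (left_cols M A * B) *\<^sub>v d)"
  shows "mat_inv (transpose_mat V * V) \<in> carrier_mat L L"
    and "kkt_coeffs A C b d = (B *\<^sub>v d - Z *\<^sub>v y) @\<^sub>v y"
proof -
  let ?C1 = "left_cols M C" and ?C2 = "right_cols M C"
  let ?A1 = "left_cols M A" and ?A2 = "right_cols M A"
  \<comment> \<open>\<open>G\<close> satisfies the constraints with all trailing coefficients zero,
    \<open>T\<close> completes trailing coefficients to a vector in the kernel of \<open>C\<close>,
    and \<open>E\<close> reads them off. The empty lower blocks of \<open>E\<close> give it the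
    shape required by \<open>append_rows_mult\<close>.\<close>
  define G where "G = B @\<^sub>r 0\<^sub>m L M"
  define T where "T = (- Z) @\<^sub>r 1\<^sub>m L"
  define E where "E = four_block_mat (0\<^sub>m L M) (1\<^sub>m L) (0\<^sub>m 0 M) (0\<^sub>m 0 L :: real mat)"
  have C1: "?C1 \<in> carrier_mat M M" and C2: "?C2 \<in> carrier_mat M L"
    and A1: "?A1 \<in> carrier_mat N M" and A2: "?A2 \<in> carrier_mat N L"
    using left_cols_carrier[OF C] right_cols_carrier[OF C]
      left_cols_carrier[OF A] right_cols_carrier[OF A] by auto
  have Z: "Z \<in> carrier_mat M L"
    unfolding Z_eq using B C2 by simp
  then have uZ: "- Z \<in> carrier_mat M L"
    by simp
  have O: "0\<^sub>m L M \<in> carrier_mat L M" and I: "1\<^sub>m L \<in> carrier_mat L L"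
    by auto
  have G: "G \<in> carrier_mat (M + L) M"
    unfolding G_def using B by (rule carrier_append_rows) simp
  have T: "T \<in> carrier_mat (M + L) L"
    unfolding T_def using uZ by (rule carrier_append_rows) simp
  have E: "E \<in> carrier_mat L (M + L)"
    unfolding E_def by (intro carrier_matI) simp_all
  have CG: "C * G = 1\<^sub>m M"
    unfolding G_def mult_append_rows[OF C B O] using C1 C2 CB by simp
  have C1Z: "?C1 * Z = ?C2"
  proof -
    have "?C1 * Z = (?C1 * B) * ?C2"
      unfolding Z_eq by (rule assoc_mult_mat[OF C1 B C2, symmetric])
    then show ?thesis
      using C2 by (simp add: CB)
  qed
  have CT: "C * T = 0\<^sub>m M L"
    unfolding T_def mult_append_rows[OF C uZ I] using C1 C2 Z
    by (simp add: C1Z uminus_mult_right_mat[of _ Z] uminus_l_inv_mat)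
  have AG: "A * G = ?A1 * B"
    unfolding G_def mult_append_rows[OF A B O] using A1 A2 B by simp
  have AT: "A * T = V"
    unfolding T_def mult_append_rows[OF A uZ I] V_eq using A1 A2 Z
    by (intro eq_matI) auto
  have left_E: "left_cols M E = 0\<^sub>m L M"
    using E left_cols_carrier[OF E, of M] by (intro eq_matI) (auto simp: left_cols_index E_def)
  have right_E: "right_cols M E = 1\<^sub>m L"
    using E right_cols_carrier[OF E] by (intro eq_matI) (auto simp: right_cols_index E_def)
  have ET: "E * T = 1\<^sub>m L"
    unfolding T_def mult_append_rows[OF E uZ I] left_E right_E using Z by (intro eq_matI) auto
  have GC: "G * C = four_block_mat (1\<^sub>m M) Z (0\<^sub>m L M) (0\<^sub>m L L)"
    unfolding G_def
    by (subst split_cols[OF C], subst append_rows_mult[OF B O C1 C2])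
      (use C1 C2 in \<open>simp add: BC flip: Z_eq\<close>)
  have TE: "T * E = four_block_mat (0\<^sub>m M M) (- Z) (0\<^sub>m L M) (1\<^sub>m L)"
    unfolding T_def E_def using append_rows_mult[OF uZ I O I] uZ by simp
  \<comment> \<open>The upper right blocks \<open>Z\<close> and \<open>- Z\<close> cancel.\<close>
  have decomp: "G * C + T * E = 1\<^sub>m (M + L)"
    unfolding GC TE using Z by (intro eq_matI) auto
  have V: "V \<in> carrier_mat N L"
    unfolding V_eq by (intro minus_carrier_mat mult_carrier_mat[OF A1 Z])
  show J: "mat_inv (transpose_mat V * V) \<in> carrier_mat L L"
    by (rule kkt_coeffs_null_space(1)[OF A C G T E CG CT ET decomp ker b d AT[symmetric]])
  have y: "y \<in> carrier_vec L"
    unfolding y_eq using J V A1 B b d by (intro mult_mat_vec_carrier[of _ L N]) auto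
  have "kkt_coeffs A C b d = G *\<^sub>v d + T *\<^sub>v y"
    using kkt_coeffs_null_space(2)[OF A C G T E CG CT ET decomp ker b d AT[symmetric]]
    unfolding y_eq AG[symmetric] assoc_mult_mat_vec[OF A G d] by simp
  also have "G *\<^sub>v d = B *\<^sub>v d @\<^sub>v 0\<^sub>v L"
    unfolding G_def mat_mult_append[OF B O d] using d by (simp add: zero_mat_mult_vec)
  also have "T *\<^sub>v y = (- Z) *\<^sub>v y @\<^sub>v y"
    unfolding T_def mat_mult_append[OF uZ I y] using y by simp
  also have "(- Z) *\<^sub>v y = - (Z *\<^sub>v y)"
    using Z y by (intro eq_vecI) auto
  also have "(B *\<^sub>v d @\<^sub>v 0\<^sub>v L) + (- (Z *\<^sub>v y) @\<^sub>v y) = (B *\<^sub>v d - Z *\<^sub>v y) @\<^sub>v y"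
    using B Z d y by (intro eq_vecI) auto
  finally show "kkt_coeffs A C b d = (B *\<^sub>v d - Z *\<^sub>v y) @\<^sub>v y" .
qed


theorem theorem1:
  fixes n m r R M N :: nat
    and S \<Sigma> :: "(real \<times> real) set"
    and x x' :: "nat \<Rightarrow> real \<times> real"
    and u :: "nat \<Rightarrow> real \<times> real \<Rightarrow> real"
    and \<M> \<C> Q Rc \<M>1 \<M>2 R11 R12 V :: "real mat"
    and K1 K2 :: real
  assumes r_gt: "m < r"
    and R_eq: "R = (r + 1) * (r + 2) div 2"
    and M_eq: "M = (m + 1) * (m + 2) div 2"
    and N_eq: "N = (n + 1)\<^sup>2"
    and R_less: "R < N"
    and sampling: "is_sampling_set n S"
    and x_enum: "bij_betw x {..<N} S"
    and mock: "is_mock_optimal m S \<Sigma>"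
    and x'_enum: "bij_betw x' {..<M} \<Sigma>"
    and basis: "is_basis_of R u (poly_space r)"
    and span_m: "fun_vs.span (u ` {..<M}) = poly_space m"
    and \<M>_eq: "\<M> = eval_mat N R u x"
    and \<C>_eq: "\<C> = eval_mat M R u x'"
    and rank_\<M>: "vec_space.rank N \<M> = R"
    and rank_\<C>: "vec_space.rank M \<C> = M"
    and QR: "is_QR \<C> Q Rc"
    and R11_eq: "R11 = left_cols M Rc"
    and R12_eq: "R12 = right_cols M Rc"
    and R11_nonsingular: "invertible_mat R11"
    and \<M>1_eq: "\<M>1 = left_cols M \<M>"
    and \<M>2_eq: "\<M>2 = right_cols M \<M>"
    and V_eq: "V = \<M>2 - \<M>1 * mat_inv R11 * R12"
    and K2_eq: "K2 = mat_norm1 (mat_inv (transpose_mat V * V) * transpose_mat V) *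
                       (real N + real M * mat_norm1 (\<M>1 * mat_inv R11 * transpose_mat Q))"
    and K1_eq: "K1 = mat_norm1 (mat_inv R11) *
                       (real M * mat_norm1 (transpose_mat Q) + mat_norm1 R12 * K2)"
  shows "op_norm (interp_regr N M R u x x') \<le>
           ereal (Max ((\<lambda>i. sup_norm (u i)) ` {..<R}) * (K1 + K2))"
proof -

  \<comment> \<open>Dimensions, location of the nodes, continuity of the basis\<close>
  define L where "L = R - M"
  \<comment> \<open>A gap of 2 between the products survives \<open>div 2\<close> as the strict
    inequality \<open>M < R\<close>. Hence \<open>R12\<close> has at least one column and
    \<open>mat_norm1 R12\<close> is a proper maximum.\<close>
  have "(m + 1) * (m + 2) + 2 \<le> (m + 2) * (m + 3)"
    by (simp add: algebra_simps)
  also have "\<dots> \<le> (r + 1) * (r + 2)"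
    using r_gt by (intro mult_mono) auto
  finally have "(m + 1) * (m + 2) + 2 \<le> (r + 1) * (r + 2)" .
  then have "M < R"
    unfolding M_eq R_eq by linarith
  then have R: "R = M + L" and L: "0 < L"
    by (auto simp: L_def)
  have M: "0 < M" and N: "0 < N"
    using R_less by (auto simp: M_eq)
  have "S \<subseteq> disk" "\<Sigma> \<subseteq> disk"
    using sampling_set_subset_disk[OF sampling] mock_optimal_subset[OF mock] by auto
  then have x_disk: "x i \<in> disk" if "i < N" for i
    using bij_betwE[OF x_enum] that by auto
  have x'_disk: "x' i \<in> disk" if "i < M" for i
    using bij_betwE[OF x'_enum] that \<open>\<Sigma> \<subseteq> disk\<close> by auto
  have u_cont: "continuous_on disk (u i)" if "i < R" for i
  proof (rule continuous_on_poly_space)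
    show "u i \<in> poly_space r"
      using basis fun_vs.span_base[of "u i" "u ` {..<R}"] that unfolding is_basis_of_def by auto
  qed

  \<comment> \<open>Block matrices from the QR factorization\<close>
  let ?X = "mat_inv R11" and ?Q' = "transpose_mat Q"
  let ?P = "mat_inv (transpose_mat V * V) * transpose_mat V"
  have A: "\<M> \<in> carrier_mat N (M + L)" and C: "\<C> \<in> carrier_mat M (M + L)"
    by (auto simp: \<M>_eq \<C>_eq eval_mat_def R)
  have Q: "Q \<in> carrier_mat M M" and Rc: "Rc \<in> carrier_mat M (M + L)"
    and Q'Q: "?Q' * Q = 1\<^sub>m M" and QQ': "Q * ?Q' = 1\<^sub>m M" and QRc: "\<C> = Q * Rc"
    using QR C by (auto simp: is_QR_def inverts_mat_def)
  have Q': "?Q' \<in> carrier_mat M M"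
    using Q by simp
  have R11: "R11 \<in> carrier_mat M M" and R12: "R12 \<in> carrier_mat M L"
    unfolding R11_eq R12_eq using left_cols_carrier[OF Rc] right_cols_carrier[OF Rc] by auto
  have M1: "\<M>1 \<in> carrier_mat N M" and M2: "\<M>2 \<in> carrier_mat N L"
    unfolding \<M>1_eq \<M>2_eq using left_cols_carrier[OF A] right_cols_carrier[OF A] by auto
  have X: "?X \<in> carrier_mat M M" and R11X: "R11 * ?X = 1\<^sub>m M" and XR11: "?X * R11 = 1\<^sub>m M"
    using mat_inv_correct[OF R11 R11_nonsingular] by auto
  have C1: "left_cols M \<C> = Q * R11" and C2: "right_cols M \<C> = Q * R12"
    unfolding QRc R11_eq R12_eq using left_cols_mult[OF Q Rc] right_cols_mult[OF Q Rc] by auto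
  have XQ': "?X * ?Q' \<in> carrier_mat M M"
    using X Q' by simp
  \<comment> \<open>Orthogonality cancels \<open>Q\<close>. With \<open>R11\<close> for
    \<open>B\<close>, this makes \<open>?X * ?Q'\<close> the inverse of the leading block of
    \<open>\<C>\<close>; with \<open>R12\<close>, it shows that \<open>?X * R12\<close> is that
    inverse times the trailing block, so \<open>V\<close> is the reduced matrix of the null-space
    method.\<close>
  have inv_l: "?X * ?Q' * (Q * B) = ?X * B" if B: "B \<in> carrier_mat M q" for B q
  proof -
    have "?X * ?Q' * (Q * B) = ?X * (?Q' * Q * B)"
      using X Q Q' B by (simp add: assoc_mult_mat[of _ M M _ M _ q])
    then show ?thesis
      using B by (simp add: Q'Q)
  qed
  have BC: "?X * ?Q' * left_cols M \<C> = 1\<^sub>m M"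
    unfolding C1 inv_l[OF R11] by (rule XR11)
  have CB: "left_cols M \<C> * (?X * ?Q') = 1\<^sub>m M"
  proof -
    have "left_cols M \<C> * (?X * ?Q') = Q * ((R11 * ?X) * ?Q')"
      unfolding C1 using Q R11 X Q' by (simp add: assoc_mult_mat[of _ M M _ M _ M])
    then show ?thesis
      using Q' by (simp add: R11X QQ')
  qed
  have Z: "?X * R12 = ?X * ?Q' * right_cols M \<C>"
    unfolding C2 inv_l[OF R12] ..
  have V_eq': "V = right_cols M \<M> - left_cols M \<M> * (?X * R12)"
    unfolding V_eq \<M>1_eq[symmetric] \<M>2_eq[symmetric] assoc_mult_mat[OF M1 X R12] ..
  have V: "V \<in> carrier_mat N L"
    unfolding V_eq by (intro minus_carrier_mat mult_carrier_mat[OF mult_carrier_mat[OF M1 X] R12])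
  have ker: "a = 0\<^sub>v (M + L)" if "a \<in> carrier_vec (M + L)" "\<M> *\<^sub>v a = 0\<^sub>v N" for a
    using vec_space.full_rank_kernel_trivial[OF A _ that] rank_\<M> R by simp
  have M1XQ': "\<M>1 * ?X * ?Q' \<in> carrier_mat N M"
    using M1 X Q' by simp

  \<comment> \<open>Estimates for a function of norm 1\<close>
  have "sup_norm (interp_regr N M R u x x' f)
      \<le> Max ((\<lambda>i. sup_norm (u i)) ` {..<R}) * (K1 + K2)"
    if f: "continuous_on disk f" "sup_norm f = 1" for f
  proof -
    have f_le: "\<bar>f z\<bar> \<le> 1" if "z \<in> disk" for z
      using abs_le_sup_norm[OF f(1) that] f(2) by simp
    define b where "b = vec N (\<lambda>i. f (x i))"
    define d where "d = vec M (\<lambda>i. f (x' i))"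
    have b: "b \<in> carrier_vec N" and d: "d \<in> carrier_vec M"
      by (auto simp: b_def d_def)
    \<comment> \<open>All entries are values of \<open>f\<close> at points of the disk, hence at
      most 1 in absolute value. The factors \<open>N\<close> and \<open>M\<close> in
      \<open>K1\<close> and \<open>K2\<close> count these entries.\<close>
    have b_le: "vec_norm1 b \<le> real N" and d_le: "vec_norm1 d \<le> real M"
      unfolding b_def d_def by (intro vec_norm1_le_dim f_le x_disk x'_disk; assumption)+
    define h where "h = b - (\<M>1 * ?X * ?Q') *\<^sub>v d"
    define y where "y = ?P *\<^sub>v h"
    \<comment> \<open>\<open>?X\<close> stays factored out of both terms, so that its norm enters
      once, in front of the sum, as in \<open>K1\<close>.\<close>
    define a1 where "a1 = ?X *\<^sub>v (?Q' *\<^sub>v d - R12 *\<^sub>v y)"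
    have y_eq: "y = ?P *\<^sub>v (b - (left_cols M \<M> * (?X * ?Q')) *\<^sub>v d)"
      unfolding y_def h_def \<M>1_eq[symmetric] assoc_mult_mat[OF M1 X Q'] ..
    note kkt = kkt_coeffs_blocks[OF A C XQ' BC CB ker b d Z V_eq' y_eq]
    have P: "?P \<in> carrier_mat L N"
      using kkt(1) V by auto
    have h: "h \<in> carrier_vec N"
      unfolding h_def using b M1XQ' d by auto
    have y: "y \<in> carrier_vec L"
      unfolding y_def using P h by auto
    have Q'd: "?Q' *\<^sub>v d \<in> carrier_vec M" and R12y: "R12 *\<^sub>v y \<in> carrier_vec M"
      using Q' d R12 y by auto
    have "a1 = ?X *\<^sub>v (?Q' *\<^sub>v d) - ?X *\<^sub>v (R12 *\<^sub>v y)"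
      unfolding a1_def by (rule mult_minus_distrib_mat_vec[OF X Q'd R12y])
    also have "\<dots> = (?X * ?Q') *\<^sub>v d - (?X * R12) *\<^sub>v y"
      by (simp add: assoc_mult_mat_vec[OF X Q' d] assoc_mult_mat_vec[OF X R12 y])
    finally have a_eq: "kkt_coeffs \<M> \<C> b d = a1 @\<^sub>v y"
      using kkt(2) by simp

    have "vec_norm1 ((\<M>1 * ?X * ?Q') *\<^sub>v d) \<le> mat_norm1 (\<M>1 * ?X * ?Q') * vec_norm1 d"
      by (rule vec_norm1_mult_mat_vec_le[OF M1XQ' d M])
    also have "\<dots> \<le> mat_norm1 (\<M>1 * ?X * ?Q') * real M"
      using d_le M1XQ' M by (intro mult_left_mono mat_norm1_nonneg) auto
    finally have "vec_norm1 h \<le> real N + real M * mat_norm1 (\<M>1 * ?X * ?Q')"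
      using vec_norm1_diff_le[of b "(\<M>1 * ?X * ?Q') *\<^sub>v d"] b_le carrier_matD[OF M1] b unfolding h_def
      by (simp add: mult.commute)
    moreover have "vec_norm1 y \<le> mat_norm1 ?P * vec_norm1 h"
      unfolding y_def by (rule vec_norm1_mult_mat_vec_le[OF P h N])
    moreover have "0 \<le> mat_norm1 ?P"
      using P N by (intro mat_norm1_nonneg) auto
    ultimately have y_le: "vec_norm1 y \<le> K2"
      unfolding K2_eq by (meson mult_left_mono order_trans)

    have "vec_norm1 (?Q' *\<^sub>v d) \<le> mat_norm1 ?Q' * vec_norm1 d"
      by (rule vec_norm1_mult_mat_vec_le[OF Q' d M])
    also have "\<dots> \<le> mat_norm1 ?Q' * real M"
      using d_le Q' M by (intro mult_left_mono mat_norm1_nonneg) auto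
    finally have Q'd_le: "vec_norm1 (?Q' *\<^sub>v d) \<le> real M * mat_norm1 ?Q'"
      by (simp add: mult.commute)
    have "vec_norm1 (R12 *\<^sub>v y) \<le> mat_norm1 R12 * vec_norm1 y"
      by (rule vec_norm1_mult_mat_vec_le[OF R12 y L])
    also have "\<dots> \<le> mat_norm1 R12 * K2"
      using y_le R12 L by (intro mult_left_mono mat_norm1_nonneg) auto
    finally have "vec_norm1 (?Q' *\<^sub>v d - R12 *\<^sub>v y) \<le> real M * mat_norm1 ?Q' + mat_norm1 R12 * K2"
      using vec_norm1_diff_le[of "?Q' *\<^sub>v d" "R12 *\<^sub>v y"] Q'd_le carrier_matD[OF Q] carrier_matD[OF R12] by simp
    moreover have "vec_norm1 a1 \<le> mat_norm1 ?X * vec_norm1 (?Q' *\<^sub>v d - R12 *\<^sub>v y)"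
      unfolding a1_def using Q'd R12y by (intro vec_norm1_mult_mat_vec_le[OF X _ M]) auto
    moreover have "0 \<le> mat_norm1 ?X"
      using X M by (intro mat_norm1_nonneg) auto
    ultimately have a1_le: "vec_norm1 a1 \<le> K1"
      unfolding K1_eq by (meson mult_left_mono order_trans)

    let ?U = "Max ((\<lambda>i. sup_norm (u i)) ` {..<R})"
    \<comment> \<open>Nonnegativity of the maximum permits multiplying the coefficient bound by it.
      It follows from the value of the first basis function at the origin; that function exists
      because \<open>R > 0\<close>.\<close>
    have "0 \<le> sup_norm (u 0)"
      using abs_le_sup_norm[OF u_cont, of 0 0] R L by (auto simp: disk_def intro: order_trans[OF abs_ge_zero])
    also have "\<dots> \<le> ?U"
      using R L by (intro Max_ge) auto
    finally have U: "0 \<le> ?U" .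
    have a: "a1 @\<^sub>v y \<in> carrier_vec R"
      unfolding R a1_def using X Q'd R12y y by (intro append_carrier_vec) auto
    have "vec_norm1 (a1 @\<^sub>v y) \<le> K1 + K2"
      unfolding vec_norm1_append using a1_le y_le by simp
    then have U_le: "?U * vec_norm1 (a1 @\<^sub>v y) \<le> ?U * (K1 + K2)"
      using U by (rule mult_left_mono)
    have "interp_regr N M R u x x' f = (\<lambda>z. \<Sum>i<R. (a1 @\<^sub>v y) $ i * u i z)"
      using a_eq unfolding interp_regr_def b_def d_def \<M>_eq \<C>_eq by (simp add: Let_def)
    then show ?thesis
      using abs_lincomb_le[where u = u, OF a _ u_cont] U_le by (auto intro!: sup_norm_le order_trans[OF _ U_le])
  qed
  then show ?thesis
    unfolding op_norm_def by (intro SUP_least) auto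
qed

end
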